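(* Let $X$ be a Polish space and $\mathbf f=(f_n)_n$ a sequence of real-valued Borel functions on $X$. Let $$\mathcal L^1_{\mathbf f}=\{L\in[\mathbb N]:(f_n)_{n\in L}\text{ converges pointwise to a Baire-1 function}\}.$$ Then for every Borel set $C\subseteq\mathcal L^1_{\mathbf f}$, $$\sup\{\alpha(f_L):L\in C\}<\omega_1,$$ where $f_L$ denotes the pointwise limit of $(f_n)_{n\in L}$.
   Context: $[\mathbb N]$ is the set of infinite subsets of $\mathbb N$, a Polish subspace of $2^{\mathbb N}$; $(f_n)_{n\in L}$ is the subsequence along the increasing enumeration of $L$. Separation rank: for $f:X\to\mathbb R$, reals $a<b$ and closed $F\subseteq X$, $F'_{f,a,b}=\overline{F\cap[f<a]}\cap\overline{F\cap[f>b]}$; iterate transfinitely ($F^{(0)}=F$, successor = derivative, intersections at limits); $\alpha(f,F,a,b)$ is the least $\xi$ with $F^{(\xi)}_{f,a,b}=\varnothing$ if one exists below $\omega_1$, else $\omega_1$; $\alpha(f,a,b)=\alpha(f,X,a,b)$ and $\alpha(f)=\sup\{\alpha(f,a,b):a,b\in\mathbb Q,\ a<b\}$. *)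

theory Defs
  imports "HOL-Analysis.Analysis" "HOL-Library.Infinite_Set"
begin

definition baire1 :: "('a::topological_space \<Rightarrow> real) \<Rightarrow> bool" where
  "baire1 g \<longleftrightarrow> (\<exists>h :: nat \<Rightarrow> 'a \<Rightarrow> real. (\<forall>n. continuous_on UNIV (h n)) \<and>
      (\<forall>x. (\<lambda>n. h n x) \<longlonglongrightarrow> g x))"

definition subseq_along :: "(nat \<Rightarrow> 'b) \<Rightarrow> nat set \<Rightarrow> nat \<Rightarrow> 'b" where
  "subseq_along f L = (\<lambda>k. f (Infinite_Set.enumerate L k))"

definition infsets :: "nat set set" where
  "infsets = {L. infinite L}"

definition charfun :: "nat set \<Rightarrow> (nat \<Rightarrow> bool)" where
  "charfun L = (\<lambda>n. n \<in> L)"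

text \<open>Borel subsets of [N], with [N] viewed as a subspace of 2^N = (nat => bool) with the product topology.\<close>
definition borel_infsets :: "nat set set \<Rightarrow> bool" where
  "borel_infsets C \<longleftrightarrow> C \<subseteq> infsets \<and>
     charfun ` C \<in> sets (restrict_space (borel :: (nat \<Rightarrow> bool) measure) (charfun ` infsets))"

definition L1set :: "(nat \<Rightarrow> 'a::topological_space \<Rightarrow> real) \<Rightarrow> nat set set" where
  "L1set f = {L \<in> infsets. \<exists>g. baire1 g \<and> (\<forall>x. (\<lambda>k. subseq_along f L k x) \<longlonglongrightarrow> g x)}"

definition limit_along :: "(nat \<Rightarrow> 'a \<Rightarrow> real) \<Rightarrow> nat set \<Rightarrow> 'a \<Rightarrow> real" where
  "limit_along f L = (\<lambda>x. lim (\<lambda>k. subseq_along f L k x))"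

definition sep_deriv :: "('a::topological_space \<Rightarrow> real) \<Rightarrow> real \<Rightarrow> real \<Rightarrow> 'a set \<Rightarrow> 'a set" where
  "sep_deriv f a b F = closure (F \<inter> {x. f x < a}) \<inter> closure (F \<inter> {x. f x > b})"

text \<open>Transfinite iteration F^(xi)_{f,a,b} along a well-order r (ordinals are represented by
  the elements of the field of a well-order): the least element gives F, a successor of eta
  gives the derivative of F^(eta), a limit gives the intersection of the earlier stages.\<close>
definition is_succ_of :: "'i rel \<Rightarrow> 'i \<Rightarrow> 'i \<Rightarrow> bool" where
  "is_succ_of r \<eta> \<xi> \<longleftrightarrow> (\<eta>, \<xi>) \<in> r - Id \<and> (\<forall>\<zeta>. (\<eta>, \<zeta>) \<in> r - Id \<longrightarrow> (\<xi>, \<zeta>) \<in> r)"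

definition sep_iter :: "'i rel \<Rightarrow> ('a::topological_space \<Rightarrow> real) \<Rightarrow> real \<Rightarrow> real \<Rightarrow> 'a set \<Rightarrow> 'i \<Rightarrow> 'a set" where
  "sep_iter r f a b F = wfrec (r - Id) (\<lambda>rec \<xi>.
     if \<exists>\<eta>. is_succ_of r \<eta> \<xi> then sep_deriv f a b (rec (THE \<eta>. is_succ_of r \<eta> \<xi>))
     else F \<inter> (\<Inter>\<eta>\<in>{\<eta>. (\<eta>, \<xi>) \<in> r - Id}. rec \<eta>))"

text \<open>alpha(f) is at most the order type of the (countable) well-order r: for all rational a < b
  some stage xi in the field of r has F^(xi)_{f,X,a,b} empty (F = X = UNIV).\<close>
definition sep_rank_bounded_by :: "'i rel \<Rightarrow> ('a::topological_space \<Rightarrow> real) \<Rightarrow> bool" where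
  "sep_rank_bounded_by r f \<longleftrightarrow>
     (\<forall>a\<in>\<rat>. \<forall>b\<in>\<rat>. a < b \<longrightarrow> (\<exists>\<xi>\<in>Field r. sep_iter r f a b UNIV \<xi> = {}))"

end

theory Submission
  imports Defs
begin

text \<open>
  The argument is in the style of the Kunen--Martin theorem. If $x_0, \dots, x_{n-1}$ lie in
  $F^{(\xi)}$, then for every $\eta < \xi$ a further point $x_n \in F^{(\eta)}$ can be found close to
  any prescribed $x_i$ and with $f_L(x_n) < a$ or $f_L(x_n) > b$, as one likes. Hence $\xi$ is at most
  the rank of $(x_0, \dots, x_{n-1})$ in the tree of finite attempts to build a sequence whose closure
  $D$ has both level sets $D \cap [f_L < a]$ and $D \cap [f_L > b]$ dense; by the Baire category
  theorem no such sequence exists for a Baire-1 function. These trees depend on $L$, but the conditions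
  on the pairs $(L, x_k)$ are Borel, hence analytic. Replacing each pair by a finite part of a
  witness in $\mathbb N^{\mathbb N}$ maps all trees, for all $L \in C$, into one countable tree. An
  infinite branch there converges to some $L \in C$ with an infinite branch in its own tree, so the
  countable tree is well-founded and its rank bounds all separation ranks.
\<close>

subsection \<open>Well-orders and iterated derivatives\<close>

text \<open>The rank of a point is the least element, in a well-order of the uncountable type of sets of
  naturals, that is not the rank of a predecessor; ties are broken by the order of the naturals.\<close>

lemma wf_extend_Well_order:
  fixes R :: "nat rel"
  assumes "wf R"
  obtains r :: "nat rel" where "Well_order r" "Field r = UNIV" "R \<subseteq> r - Id"
proof -
  obtain w :: "nat set rel" where w: "Well_order w" "Field w = UNIV"
    using well_ordering[where 'a = "nat set"] by (elim exE conjE)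
  define W where "W = w - Id"
  have wfW: "wf W"
    using w unfolding W_def well_order_on_def by blast
  have totW: "A = B \<or> (A, B) \<in> W \<or> (B, A) \<in> W" for A B
    using w unfolding W_def well_order_on_def linear_order_on_def total_on_def by auto
  have transW: "trans W"
    using w unfolding W_def well_order_on_def linear_order_on_def partial_order_on_def
      preorder_on_def by (meson trans_diff_Id)
  \<comment> \<open>By transitivity, what lies below t also lies below s whenever t is below s.
    Hence the values used below t are used below s, and the rank is strictly increasing.\<close>
  define T where "T = R\<^sup>+"
  have wfT: "wf T" and transT: "trans T"
    using assms unfolding T_def by (auto intro: wf_trancl)
  define pick where
    "pick = (\<lambda>(g :: nat \<Rightarrow> nat set) s. SOME A. A \<notin> g ` {t. (t, s) \<in> T} \<and>
       (\<forall>B. (B, A) \<in> W \<longrightarrow> B \<in> g ` {t. (t, s) \<in> T}))"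
  define rk where "rk = wfrec T pick"
  have rk_eq: "rk s = pick rk s" for s
  proof -
    have "rk s = pick (cut rk T s) s"
      unfolding rk_def by (rule wfrec[OF wfT])
    moreover have "cut rk T s ` {t. (t, s) \<in> T} = rk ` {t. (t, s) \<in> T}"
      by (rule image_cong) (simp_all add: cut_apply)
    ultimately show ?thesis
      by (simp add: pick_def)
  qed
  have rk: "rk s \<notin> rk ` {t. (t, s) \<in> T}" "(B, rk s) \<in> W \<Longrightarrow> B \<in> rk ` {t. (t, s) \<in> T}" for s B
  proof -
    \<comment> \<open>Only countably many ranks are taken, while the sets of naturals are
      uncountable by Cantor, so a least free value exists.\<close>
    have "rk ` {t. (t, s) \<in> T} \<noteq> UNIV"
    proof
      assume "rk ` {t. (t, s) \<in> T} = UNIV"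
      then have "UNIV \<subseteq> range rk"
        by (metis image_mono subset_UNIV)
      then have "rk ` UNIV = Pow UNIV"
        by auto
      then show False
        using Cantors_theorem[of "UNIV :: nat set"] by blast
    qed
    then obtain A' where A': "A' \<in> - (rk ` {t. (t, s) \<in> T})"
      by auto
    obtain A where A: "A \<in> - (rk ` {t. (t, s) \<in> T})"
      and min: "\<And>B. (B, A) \<in> W \<Longrightarrow> B \<notin> - (rk ` {t. (t, s) \<in> T})"
      by (rule wfE_min[OF wfW A']) iprover
    have "rk s \<notin> rk ` {t. (t, s) \<in> T} \<and> (\<forall>B. (B, rk s) \<in> W \<longrightarrow> B \<in> rk ` {t. (t, s) \<in> T})"
      unfolding rk_eq[of s] pick_def by (rule someI[of _ A]) (use A min in blast)
    then show "rk s \<notin> rk ` {t. (t, s) \<in> T}" "(B, rk s) \<in> W \<Longrightarrow> B \<in> rk ` {t. (t, s) \<in> T}"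
      by blast+
  qed
  have mono: "(rk t, rk s) \<in> W" if "(t, s) \<in> T" for s t
  proof -
    have "rk t \<noteq> rk s"
      using rk(1)[of s] that by (metis image_eqI mem_Collect_eq)
    moreover have "(rk s, rk t) \<notin> W"
    proof
      assume "(rk s, rk t) \<in> W"
      then obtain u where "(u, t) \<in> T" "rk s = rk u"
        using rk(2) by blast
      moreover have "(u, s) \<in> T"
        using \<open>(u, t) \<in> T\<close> that transT by (meson transD)
      ultimately show False
        using rk(1)[of s] by blast
    qed
    ultimately show ?thesis
      using totW by blast
  qed
  define lt where "lt = inv_image (W <*lex*> less_than) (\<lambda>s. (rk s, s))"
  have lt: "(s, t) \<in> lt \<longleftrightarrow> (rk s, rk t) \<in> W \<or> rk s = rk t \<and> s < t" for s t
    by (auto simp: lt_def)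
  have wflt: "wf lt"
    unfolding lt_def by (intro wf_inv_image wf_lex_prod wfW wf_less_than)
  have irrefl: "(s, s) \<notin> lt" for s
    using wflt by (metis wf_not_refl)
  have transW': "(A, B) \<in> W \<Longrightarrow> (B, D) \<in> W \<Longrightarrow> (A, D) \<in> W" for A B D
    using transW by (meson transD)
  have translt: "(s, t) \<in> lt \<Longrightarrow> (t, u) \<in> lt \<Longrightarrow> (s, u) \<in> lt" for s t u
    unfolding lt by (elim disjE conjE) (auto intro: transW')
  have totlt: "s = t \<or> (s, t) \<in> lt \<or> (t, s) \<in> lt" for s t
    unfolding lt using totW[of "rk s" "rk t"] by auto
  define r where "r = lt \<union> Id"
  have rId: "r - Id = lt"
    using irrefl by (auto simp: r_def)
  have Field: "Field r = UNIV"
    by (auto simp: r_def Field_def)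
  have "Well_order r"
    unfolding Field well_order_on_def linear_order_on_def partial_order_on_def preorder_on_def rId
  proof (intro conjI wflt)
    show "r \<subseteq> UNIV \<times> UNIV" "refl r"
      by (auto simp: r_def refl_on_def)
    show "trans r"
      by (rule transI) (use translt in \<open>auto simp: r_def\<close>)
    show "antisym r"
      by (rule antisymI) (use translt irrefl in \<open>auto simp: r_def\<close>)
    show "total r"
      using totlt by (auto simp: r_def total_on_def)
  qed
  moreover have "R \<subseteq> r - Id"
    unfolding rId using mono by (intro subrelI) (simp add: lt T_def r_into_trancl')
  ultimately show ?thesis
    using Field that by blast
qed

text \<open>The disjoint sum of all \<open>R i\<close> with an added top point is well-founded and
  countable, so it transfers to the naturals and extends to a well-order. The top point becomes
  \<tau>, a single stage above every node of every relation.\<close>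

lemma wf_family_embed_Well_order:
  fixes R :: "'i::countable \<Rightarrow> 'n::countable rel"
  assumes "\<And>i. wf (R i)"
  obtains r :: "nat rel" and \<phi> :: "'i \<Rightarrow> 'n \<Rightarrow> nat" and \<tau> :: nat
  where "Well_order r" "Field r = UNIV"
    "\<And>i n. (\<phi> i n, \<tau>) \<in> r - Id"
    "\<And>i m n. (m, n) \<in> R i \<Longrightarrow> (\<phi> i m, \<phi> i n) \<in> r - Id"
proof -
  \<comment> \<open>The tags 0 and 1 put every node below \<open>None\<close>, and that comparison
    never looks at \<open>undefined\<close>.\<close>
  define S where "S = inv_image (less_than <*lex*> same_fst (\<lambda>_. True) R)
    (\<lambda>z :: ('i \<times> 'n) option. case z of None \<Rightarrow> (1, undefined) | Some p \<Rightarrow> (0, p))"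
  have "wf S"
    unfolding S_def by (intro wf_inv_image wf_lex_prod wf_less_than wf_same_fst assms)
  then have "wf (map_prod to_nat to_nat ` S)"
    by (rule wf_map_prod_image) simp
  then obtain r where r: "Well_order r" "Field r = UNIV" "map_prod to_nat to_nat ` S \<subseteq> r - Id"
    using wf_extend_Well_order by blast
  have S: "(to_nat x, to_nat y) \<in> r - Id" if "(x, y) \<in> S" for x y
    using r(3) that by force
  show ?thesis
  proof (rule that[of r "\<lambda>i n. to_nat (Some (i, n))" "to_nat (None :: ('i \<times> 'n) option)"])
    show "(to_nat (Some (i, n)), to_nat (None :: ('i \<times> 'n) option)) \<in> r - Id" for i :: 'i and n :: 'n
      by (rule S) (simp add: S_def)
    show "(to_nat (Some (i, m)), to_nat (Some (i, n))) \<in> r - Id" if "(m, n) \<in> R i" for i m n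
      by (rule S) (use that in \<open>auto simp: S_def\<close>)
  qed (fact r)+
qed

section \<open>Immediate successors and the stages of the iterated derivative\<close>

lemma is_succ_ofD: "is_succ_of r \<eta> \<xi> \<Longrightarrow> (\<eta>, \<xi>) \<in> r - Id"
  by (simp add: is_succ_of_def)

lemma is_succ_of_unique:
  assumes "antisym r" "total_on (Field r) r" "is_succ_of r \<eta> \<xi>" "is_succ_of r \<eta>' \<xi>"
  shows "\<eta> = \<eta>'"
proof (rule ccontr)
  assume "\<eta> \<noteq> \<eta>'"
  moreover have "\<eta> \<in> Field r" "\<eta>' \<in> Field r"
    using assms(3,4) by (auto simp: is_succ_of_def Field_def)
  ultimately have "(\<eta>, \<eta>') \<in> r - Id \<or> (\<eta>', \<eta>) \<in> r - Id"
    using assms(2) by (auto simp: total_on_def)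
  then have "(\<xi>, \<eta>') \<in> r \<or> (\<xi>, \<eta>) \<in> r"
    using assms(3,4) by (auto simp: is_succ_of_def)
  then show False
    using assms(1,3,4) by (auto simp: is_succ_of_def dest: antisymD)
qed

lemma ex_is_succ_of:
  assumes "Well_order r" "(\<eta>, \<xi>) \<in> r - Id"
  obtains \<zeta> where "is_succ_of r \<eta> \<zeta>" "(\<zeta>, \<xi>) \<in> r"
proof -
  have wf: "wf (r - Id)" and tot: "total_on (Field r) r" and refl: "refl_on (Field r) r"
    using assms(1)
    by (auto simp: well_order_on_def linear_order_on_def partial_order_on_def preorder_on_def)
  obtain \<zeta> where \<zeta>: "(\<eta>, \<zeta>) \<in> r - Id"
    and min: "\<And>\<mu>. (\<mu>, \<zeta>) \<in> r - Id \<Longrightarrow> (\<eta>, \<mu>) \<notin> r - Id"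
    using wfE_min[OF wf, of \<xi> "{\<mu>. (\<eta>, \<mu>) \<in> r - Id}"] assms(2) by auto
  have "(\<zeta>, \<mu>) \<in> r" if "(\<eta>, \<mu>) \<in> r - Id" for \<mu>
  proof -
    have "\<zeta> \<in> Field r" "\<mu> \<in> Field r"
      using \<zeta> that by (auto simp: Field_def)
    then show ?thesis
      using min[of \<mu>] that tot refl unfolding total_on_def refl_on_def by (metis DiffI pair_in_Id_conv)
  qed
  with \<zeta> have "is_succ_of r \<eta> \<zeta>"
    by (simp add: is_succ_of_def)
  with that assms(2) show ?thesis
    by (auto simp: is_succ_of_def)
qed

text \<open>All recursive calls go strictly below \<xi>, so \<open>cut\<close> changes nothing. In
  the successor case this rests on the uniqueness of the immediate predecessor.\<close>

lemma sep_iter_eq: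
  assumes "Well_order r"
  shows "sep_iter r f a b F \<xi> =
    (if \<exists>\<eta>. is_succ_of r \<eta> \<xi> then sep_deriv f a b (sep_iter r f a b F (THE \<eta>. is_succ_of r \<eta> \<xi>))
     else F \<inter> (\<Inter>\<eta>\<in>{\<eta>. (\<eta>, \<xi>) \<in> r - Id}. sep_iter r f a b F \<eta>))"
proof -
  have wf: "wf (r - Id)" and tot: "total_on (Field r) r" and anti: "antisym r"
    using assms
    by (auto simp: well_order_on_def linear_order_on_def partial_order_on_def)
  have "(THE \<eta>. is_succ_of r \<eta> \<xi>, \<xi>) \<in> r - Id" if "\<exists>\<eta>. is_succ_of r \<eta> \<xi>"
  proof -
    have "is_succ_of r (THE \<eta>. is_succ_of r \<eta> \<xi>) \<xi>"
    proof (rule theI')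
      show "\<exists>!\<eta>. is_succ_of r \<eta> \<xi>"
        using that is_succ_of_unique[OF anti tot] by (metis (no_types))
    qed
    then show ?thesis
      by (rule is_succ_ofD)
  qed
  then have 1: "cut (sep_iter r f a b F) (r - Id) \<xi> (THE \<eta>. is_succ_of r \<eta> \<xi>) =
      sep_iter r f a b F (THE \<eta>. is_succ_of r \<eta> \<xi>)" if "\<exists>\<eta>. is_succ_of r \<eta> \<xi>"
    using that by (intro cut_apply)
  have 2: "(\<Inter>\<eta>\<in>{\<eta>. (\<eta>, \<xi>) \<in> r - Id}. cut (sep_iter r f a b F) (r - Id) \<xi> \<eta>) =
      (\<Inter>\<eta>\<in>{\<eta>. (\<eta>, \<xi>) \<in> r - Id}. sep_iter r f a b F \<eta>)"
    by (rule INF_cong) (simp_all only: cut_apply mem_Collect_eq)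
  have 3: "sep_iter r f a b F \<xi> =
    (if \<exists>\<eta>. is_succ_of r \<eta> \<xi>
     then sep_deriv f a b (cut (sep_iter r f a b F) (r - Id) \<xi> (THE \<eta>. is_succ_of r \<eta> \<xi>))
     else F \<inter> (\<Inter>\<eta>\<in>{\<eta>. (\<eta>, \<xi>) \<in> r - Id}. cut (sep_iter r f a b F) (r - Id) \<xi> \<eta>))"
    unfolding sep_iter_def by (rule wfrec[OF wf])
  show ?thesis
    by (rule 3[THEN trans]) (simp only: 1 2 cong: if_cong)
qed

lemma sep_iter_succ:
  assumes "Well_order r" "is_succ_of r \<eta> \<xi>"
  shows "sep_iter r f a b F \<xi> = sep_deriv f a b (sep_iter r f a b F \<eta>)"
proof -
  have "total_on (Field r) r" "antisym r"
    using assms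
    by (auto simp: well_order_on_def linear_order_on_def partial_order_on_def)
  then have "(THE \<eta>. is_succ_of r \<eta> \<xi>) = \<eta>"
    using assms(2) is_succ_of_unique by (metis the_equality)
  then show ?thesis
    using assms by (subst sep_iter_eq) auto
qed

lemma sep_deriv_subset_closed: "closed F \<Longrightarrow> sep_deriv f a b F \<subseteq> F"
  unfolding sep_deriv_def by (metis closure_minimal inf_le1 le_infI1)

lemma sep_deriv_mono: "F \<subseteq> G \<Longrightarrow> sep_deriv f a b F \<subseteq> sep_deriv f a b G"
  unfolding sep_deriv_def by (intro Int_mono closure_mono) auto

text \<open>Both claims share one induction, as the inclusion of a derivative in its set comes from
  closedness. Comparing with the derivative of every earlier stage spares later arguments the
  distinction between successors and limits.\<close>

lemma sep_iter_closed_decreasing: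
  assumes "Well_order r" "closed F"
  shows "closed (sep_iter r f a b F \<xi>) \<and>
    (\<forall>\<eta>. (\<eta>, \<xi>) \<in> r - Id \<longrightarrow> sep_iter r f a b F \<xi> \<subseteq> sep_deriv f a b (sep_iter r f a b F \<eta>))"
proof -
  let ?G = "sep_iter r f a b F"
  have wf: "wf (r - Id)" and tot: "total_on (Field r) r" and anti: "antisym r"
    using assms
    by (auto simp: well_order_on_def linear_order_on_def partial_order_on_def)
  show ?thesis
    using wf
  proof (induction \<xi> rule: wf_induct_rule)
    case (less \<xi>)
    show ?case
    proof (cases "\<exists>\<zeta>. is_succ_of r \<zeta> \<xi>")
      case True
      then obtain \<zeta> where \<zeta>: "is_succ_of r \<zeta> \<xi>"
        by blast
      then have *: "?G \<xi> = sep_deriv f a b (?G \<zeta>)" and lt: "(\<zeta>, \<xi>) \<in> r - Id"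
        by (simp_all add: sep_iter_succ[OF assms(1)] is_succ_of_def)
      have "?G \<zeta> \<subseteq> ?G \<eta>" if "(\<eta>, \<xi>) \<in> r - Id" for \<eta>
      proof (cases "\<eta> = \<zeta>")
        case False
        have "(\<zeta>, \<eta>) \<notin> r - Id"
          using \<zeta> that anti by (auto simp: is_succ_of_def dest: antisymD)
        moreover have "\<zeta> \<in> Field r" "\<eta> \<in> Field r"
          using lt that by (auto simp: Field_def)
        ultimately have "(\<eta>, \<zeta>) \<in> r - Id"
          using tot False by (auto simp: total_on_def)
        then have "?G \<zeta> \<subseteq> sep_deriv f a b (?G \<eta>)"
          using less lt by blast
        also have "\<dots> \<subseteq> ?G \<eta>"
          using less that sep_deriv_subset_closed by blast
        finally show ?thesis .
      qed simp
      moreover have "closed (?G \<xi>)"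
        unfolding * by (simp add: sep_deriv_def closed_Int)
      ultimately show ?thesis
        unfolding * using sep_deriv_mono by blast
    next
      case False
      then have *: "?G \<xi> = F \<inter> (\<Inter>\<eta>\<in>{\<eta>. (\<eta>, \<xi>) \<in> r - Id}. ?G \<eta>)"
        by (subst sep_iter_eq[OF assms(1)]) simp
      \<comment> \<open>As \<xi> is not a successor, the successor of \<eta> is still strictly
        before \<xi>, so its stage is among the intersected sets.\<close>
      have "?G \<xi> \<subseteq> sep_deriv f a b (?G \<eta>)" if \<eta>: "(\<eta>, \<xi>) \<in> r - Id" for \<eta>
      proof -
        obtain \<zeta> where \<zeta>: "is_succ_of r \<eta> \<zeta>" "(\<zeta>, \<xi>) \<in> r"
          using ex_is_succ_of[OF assms(1) \<eta>] .
        then have "(\<zeta>, \<xi>) \<in> r - Id"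
          using False by auto
        then have "?G \<xi> \<subseteq> ?G \<zeta>"
          unfolding * by blast
        then show ?thesis
          using sep_iter_succ[OF assms(1) \<zeta>(1)] by metis
      qed
      moreover have "closed (?G \<xi>)"
        unfolding * using less assms(2) by (intro closed_Int closed_INT) auto
      ultimately show ?thesis
        by blast
    qed
  qed
qed

subsection \<open>Borel sets are analytic\<close>

text \<open>The function $w$ picks a preimage of each point of $A$, and the condition says that its inverse
  extends continuously from the range of $w$ to the closure, still with values in $A$:
  so $A$ is a continuous image of a closed subset of the Baire space.\<close>

definition souslin_witnessed :: "'p::topological_space set \<Rightarrow> bool" where
  "souslin_witnessed A \<longleftrightarrow> (\<exists>w :: 'p \<Rightarrow> nat \<Rightarrow> nat. \<forall>p u.
     (\<forall>\<^sub>F n in sequentially. p n \<in> A) \<and> (\<forall>k. \<forall>\<^sub>F n in sequentially. w (p n) k = u k) \<longrightarrow>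
     (\<exists>q\<in>A. p \<longlonglongrightarrow> q))"

text \<open>Let \<open>w p j\<close> be the index of a point of a countable dense set within 1/(j+1)
  of p. Once coordinate j is constant, the tail of the sequence has diameter at most 2/(j+1).
  Completeness then gives a limit, and closedness keeps it in A.\<close>

lemma souslin_witnessed_closed:
  fixes A :: "'p::{complete_space,second_countable_topology} set"
  assumes "closed A"
  shows "souslin_witnessed A"
proof -
  obtain D :: "'p set" where D: "countable D" "\<And>X. open X \<Longrightarrow> X \<noteq> {} \<Longrightarrow> \<exists>d\<in>D. d \<in> X"
    using countable_dense_setE by blast
  then have "D \<noteq> {}"
    using D(2)[of UNIV] by auto
  define d where "d = from_nat_into D"
  have "\<exists>i. dist (d i) p < e" if e: "e > 0" for p e
  proof -
    obtain y where "y \<in> D" "y \<in> ball p e"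
      using D(2)[of "ball p e"] e by (metis centre_in_ball empty_iff open_ball)
    moreover obtain i where "d i = y"
      using from_nat_into_surj[OF D(1) \<open>y \<in> D\<close>] by (auto simp: d_def)
    ultimately show ?thesis
      by (metis dist_commute mem_ball)
  qed
  then have "\<forall>p j. \<exists>i. dist (d i) p < inverse (Suc j)"
    by simp
  then obtain w where w: "\<And>p j. dist (d (w p j)) p < inverse (real (Suc j))"
    by metis
  show ?thesis
    unfolding souslin_witnessed_def
  proof (intro exI[of _ w] allI impI)
    fix p u
    assume *: "(\<forall>\<^sub>F n in sequentially. p n \<in> A) \<and>
      (\<forall>k. \<forall>\<^sub>F n in sequentially. w (p n) k = u k)"
    have "Cauchy p"
    proof (rule metric_CauchyI)
      fix e :: real
      assume "e > 0"
      then obtain j where j: "inverse (real (Suc j)) < e / 2"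
        using reals_Archimedean[of "e / 2"] by auto
      obtain N where N: "w (p n) j = u j" if "n \<ge> N" for n
        using * unfolding eventually_sequentially by blast
      have "dist (d (u j)) (p n) < e / 2" if "n \<ge> N" for n
        using w[of "p n" j] N[OF that] j by simp
      then have "dist (p m) (p n) < e" if "m \<ge> N" "n \<ge> N" for m n
        using that by (metis dist_commute dist_triangle_half_r)
      then show "\<exists>M. \<forall>m\<ge>M. \<forall>n\<ge>M. dist (p m) (p n) < e"
        by blast
    qed
    then obtain q where "p \<longlonglongrightarrow> q"
      by (metis Cauchy_convergent convergentD)
    moreover have "q \<in> A"
      using Lim_in_closed_set[OF assms _ _ \<open>p \<longlonglongrightarrow> q\<close>] * by simp
    ultimately show "\<exists>q\<in>A. p \<longlonglongrightarrow> q"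
      by blast
  qed
qed

text \<open>Coordinate 0 of the new witness names a set containing p, and the rest is the witness
  for that set. Once coordinate 0 is constant, the sequence stays in a single
  \<open>A i\<close>.\<close>

lemma souslin_witnessed_UN:
  fixes A :: "nat \<Rightarrow> 'p::topological_space set"
  assumes "\<And>i. souslin_witnessed (A i)"
  shows "souslin_witnessed (\<Union>i. A i)"
proof -
  have "\<forall>i. \<exists>w :: 'p \<Rightarrow> nat \<Rightarrow> nat. \<forall>p u. (\<forall>\<^sub>F n in sequentially. p n \<in> A i) \<and>
      (\<forall>k. \<forall>\<^sub>F n in sequentially. w (p n) k = u k) \<longrightarrow> (\<exists>q\<in>A i. p \<longlonglongrightarrow> q)"
    using assms unfolding souslin_witnessed_def by blast
  then obtain w :: "nat \<Rightarrow> 'p \<Rightarrow> nat \<Rightarrow> nat"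
    where w: "\<And>i p u. \<forall>\<^sub>F n in sequentially. p n \<in> A i \<Longrightarrow>
      (\<And>k. \<forall>\<^sub>F n in sequentially. w i (p n) k = u k) \<Longrightarrow> \<exists>q\<in>A i. p \<longlonglongrightarrow> q"
    by metis
  define sel where "sel p = (SOME i. p \<in> A i)" for p
  have sel: "p \<in> A (sel p)" if "p \<in> (\<Union>i. A i)" for p
    using that unfolding sel_def by (metis UN_E someI)
  show ?thesis
    unfolding souslin_witnessed_def
  proof (intro exI[of _ "\<lambda>p. case_nat (sel p) (w (sel p) p)"] allI impI)
    fix p u
    assume *: "(\<forall>\<^sub>F n in sequentially. p n \<in> (\<Union>i. A i)) \<and>
      (\<forall>k. \<forall>\<^sub>F n in sequentially. case_nat (sel (p n)) (w (sel (p n)) (p n)) k = u k)"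
    then have 0: "\<forall>\<^sub>F n in sequentially. sel (p n) = u 0"
      by (auto dest!: spec[of _ 0])
    have "\<forall>\<^sub>F n in sequentially. p n \<in> A (u 0)"
      using 0 conjunct1[OF *] by eventually_elim (use sel in metis)
    moreover have "\<forall>\<^sub>F n in sequentially. w (u 0) (p n) k = u (Suc k)" for k
      using 0 conjunct2[OF *, rule_format, of "Suc k"] by eventually_elim simp
    ultimately show "\<exists>q\<in>\<Union>i. A i. p \<longlonglongrightarrow> q"
      using w[of p "u 0" "\<lambda>k. u (Suc k)"] by blast
  qed
qed

text \<open>Pairing merges the witnesses for all \<open>A i\<close> into one. Each gives a limit in
  its own set, and the limits agree because the space is Hausdorff.\<close>

lemma souslin_witnessed_INT:
  fixes A :: "nat \<Rightarrow> 'p::t2_space set"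
  assumes "\<And>i. souslin_witnessed (A i)"
  shows "souslin_witnessed (\<Inter>i. A i)"
proof -
  have "\<forall>i. \<exists>w :: 'p \<Rightarrow> nat \<Rightarrow> nat. \<forall>p u. (\<forall>\<^sub>F n in sequentially. p n \<in> A i) \<and>
      (\<forall>k. \<forall>\<^sub>F n in sequentially. w (p n) k = u k) \<longrightarrow> (\<exists>q\<in>A i. p \<longlonglongrightarrow> q)"
    using assms unfolding souslin_witnessed_def by blast
  then obtain w :: "nat \<Rightarrow> 'p \<Rightarrow> nat \<Rightarrow> nat"
    where w: "\<And>i p u. \<forall>\<^sub>F n in sequentially. p n \<in> A i \<Longrightarrow>
      (\<And>k. \<forall>\<^sub>F n in sequentially. w i (p n) k = u k) \<Longrightarrow> \<exists>q\<in>A i. p \<longlonglongrightarrow> q"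
    by metis
  show ?thesis
    unfolding souslin_witnessed_def
  proof (intro exI[of _ "\<lambda>p. \<lambda>j. w (fst (prod_decode j)) p (snd (prod_decode j))"] allI impI)
    fix p u
    assume *: "(\<forall>\<^sub>F n in sequentially. p n \<in> (\<Inter>i. A i)) \<and>
      (\<forall>j. \<forall>\<^sub>F n in sequentially. w (fst (prod_decode j)) (p n) (snd (prod_decode j)) = u j)"
    have "\<exists>q\<in>A i. p \<longlonglongrightarrow> q" for i
    proof (rule w[of _ _ "\<lambda>k. u (prod_encode (i, k))"])
      show "\<forall>\<^sub>F n in sequentially. p n \<in> A i"
        using conjunct1[OF *] by eventually_elim blast
      show "\<forall>\<^sub>F n in sequentially. w i (p n) k = u (prod_encode (i, k))" for k
        using conjunct2[OF *, rule_format, of "prod_encode (i, k)"] by simp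
    qed
    then show "\<exists>q\<in>\<Inter>i. A i. p \<longlonglongrightarrow> q"
      by (metis INT_I LIMSEQ_unique)
  qed
qed

text \<open>An open set in a metric space is a countable union of closed sets, here the sets of
  points at distance at least 1/(n+1) from every point of the complement.\<close>

lemma souslin_witnessed_open:
  fixes A :: "'p::{complete_space,second_countable_topology} set"
  assumes "open A"
  shows "souslin_witnessed A"
proof -
  define E where "E n = {x. \<forall>y\<in>- A. inverse (real (Suc n)) \<le> dist x y}" for n
  have "E n = (\<Inter>y\<in>- A. {x. inverse (real (Suc n)) \<le> dist x y})" for n
    by (auto simp: E_def)
  then have "closed (E n)" for n
    by (auto intro!: closed_INT closed_Collect_le continuous_intros)
  moreover have "A = (\<Union>n. E n)"
  proof (intro equalityI subsetI)
    fix x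
    assume "x \<in> A"
    then obtain e where e: "e > 0" "ball x e \<subseteq> A"
      using assms openE by blast
    obtain n where "inverse (real (Suc n)) < e"
      using reals_Archimedean e(1) by blast
    then have "x \<in> E n"
      using e(2) by (force simp: E_def)
    then show "x \<in> (\<Union>n. E n)"
      by blast
  next
    fix x
    assume "x \<in> (\<Union>n. E n)"
    then obtain n where n: "x \<in> E n"
      by blast
    show "x \<in> A"
    proof (rule ccontr)
      assume "x \<notin> A"
      then have "inverse (real (Suc n)) \<le> dist x x"
        using n unfolding E_def by blast
      then show False
        by simp
    qed
  qed
  ultimately show ?thesis
    using souslin_witnessed_UN souslin_witnessed_closed by metis
qed

lemma souslin_witnessed_borel:
  fixes A :: "'p::{complete_space,second_countable_topology} set"
  assumes "A \<in> sets borel"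
  shows "souslin_witnessed A"
proof -
  have "A \<in> sigma_sets UNIV {S. open S}"
    using assms by (simp add: borel_def)
  \<comment> \<open>Complements of analytic sets need not be analytic, so the induction carries A
    and its complement together.\<close>
  then have "souslin_witnessed A \<and> souslin_witnessed (- A)"
  proof induction
    case (Basic A)
    then show ?case
      by (simp add: souslin_witnessed_open souslin_witnessed_closed closed_Compl)
  next
    case Empty
    then show ?case
      by (simp add: souslin_witnessed_closed)
  next
    case (Compl A)
    then show ?case
      by (simp add: Compl_eq_Diff_UNIV[symmetric])
  next
    case (Union A)
    then show ?case
      by (simp add: souslin_witnessed_UN souslin_witnessed_INT)
  qed
  then show ?thesis ..
qed

subsection \<open>Borel level sets of the limits\<close>

text \<open>With a countable base for \<open>bool\<close>, a map into
  \<open>nat \<Rightarrow> bool\<close> is Borel as soon as its coordinates are, as used for the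
  decoding map below.\<close>

instance bool :: second_countable_topology
  by standard (auto intro!: exI[of _ "range (\<lambda>a. {..<a}) \<union> range (\<lambda>a. {a<..})"]
      simp: open_bool_def)

text \<open>The limit is traded for quantifiers over naturals and membership in L, from which Borel
  measurability can be read off. The margin 1/(m+1) keeps the inequality strict in the
  limit.\<close>

lemma enumerate_subseq_limit_less_iff:
  fixes g :: "nat \<Rightarrow> real"
  assumes "infinite L" "(\<lambda>k. g (enumerate L k)) \<longlonglongrightarrow> l"
  shows "l < a \<longleftrightarrow> (\<exists>m N. \<forall>n\<ge>N. n \<in> L \<longrightarrow> g n \<le> a - inverse (real (Suc m)))"
proof
  assume "l < a"
  then obtain m where "inverse (real (Suc m)) < a - l"
    using reals_Archimedean[of "a - l"] by auto
  then have "\<forall>\<^sub>F k in sequentially. g (enumerate L k) < a - inverse (real (Suc m))"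
    by (intro order_tendstoD(2)[OF assms(2)]) simp
  then obtain K where K: "\<And>k. k \<ge> K \<Longrightarrow> g (enumerate L k) < a - inverse (real (Suc m))"
    by (auto simp: eventually_sequentially)
  have "g n \<le> a - inverse (real (Suc m))" if "n \<ge> enumerate L K" "n \<in> L" for n
  proof -
    obtain k where k: "enumerate L k = n"
      using enumerate_Ex[OF assms(1) \<open>n \<in> L\<close>] by blast
    then have "k \<ge> K"
      using that(1) assms(1) by (metis enumerate_mono linorder_not_le)
    then show ?thesis
      using K k by fastforce
  qed
  then show "\<exists>m N. \<forall>n\<ge>N. n \<in> L \<longrightarrow> g n \<le> a - inverse (real (Suc m))"
    by blast
next
  assume "\<exists>m N. \<forall>n\<ge>N. n \<in> L \<longrightarrow> g n \<le> a - inverse (real (Suc m))"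
  then obtain m N where N: "\<And>n. n \<ge> N \<Longrightarrow> n \<in> L \<Longrightarrow> g n \<le> a - inverse (real (Suc m))"
    by blast
  have "g (enumerate L k) \<le> a - inverse (real (Suc m))" if "k \<ge> N" for k
    using that le_enumerate[OF assms(1), of k] enumerate_in_set[OF assms(1)] N by simp
  then have "l \<le> a - inverse (real (Suc m))"
    using LIMSEQ_le_const2[OF assms(2)] by blast
  then show "l < a"
    by (smt (verit) inverse_positive_iff_positive of_nat_0_less_iff zero_less_Suc)
qed

text \<open>Reals instead of truth values, as \<^typ>\<open>nat \<Rightarrow> real\<close> is an instance of the class of Polish
  spaces while \<^typ>\<open>nat \<Rightarrow> bool\<close> carries no metric in the library.\<close>

definition decode_real :: "(nat \<Rightarrow> real) \<Rightarrow> nat set" where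
  "decode_real y = {n. y n > 1 / 2}"

definition encode_real :: "nat set \<Rightarrow> nat \<Rightarrow> real" where
  "encode_real L n = (if n \<in> L then 1 else 0)"

lemma decode_encode_real [simp]: "decode_real (encode_real L) = L"
  by (auto simp: decode_real_def encode_real_def)

lemma measurable_nat_fun_eval [measurable]: "(\<lambda>y :: nat \<Rightarrow> real. y n) \<in> borel_measurable borel"
  by (intro borel_measurable_continuous_onI continuous_on_product_coordinates)

text \<open>Decoding is Borel in each coordinate. A relatively Borel set is the trace of a Borel set
  on the infinite sets, and being infinite is itself a Borel condition.\<close>

lemma decode_real_borel:
  assumes "borel_infsets C"
  shows "{y. decode_real y \<in> C} \<in> sets borel"
proof -
  obtain B where B: "B \<in> sets (borel :: (nat \<Rightarrow> bool) measure)"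
    and C: "charfun ` C = B \<inter> charfun ` infsets"
    using assms by (auto simp: borel_infsets_def sets_restrict_space Int_commute)
  have inj: "inj charfun"
    by (auto simp: inj_def charfun_def fun_eq_iff)
  have "decode_real y \<in> C \<longleftrightarrow> charfun (decode_real y) \<in> B \<and> infinite (decode_real y)" for y
  proof -
    have "decode_real y \<in> C \<longleftrightarrow> charfun (decode_real y) \<in> charfun ` C"
      using inj by (simp add: inj_image_mem_iff)
    also have "\<dots> \<longleftrightarrow> charfun (decode_real y) \<in> B \<and> decode_real y \<in> infsets"
      unfolding C using inj by (simp add: inj_image_mem_iff)
    finally show ?thesis
      by (simp add: infsets_def)
  qed
  moreover have "infinite (decode_real y) \<longleftrightarrow> (\<forall>m. \<exists>n. n \<ge> m \<and> y n > 1 / 2)" for y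
    by (simp add: infinite_nat_iff_unbounded_le decode_real_def)
  ultimately have eq: "{y. decode_real y \<in> C} =
      (\<lambda>y. charfun (decode_real y)) -` B \<inter> {y. \<forall>m. \<exists>n. n \<ge> m \<and> y n > 1 / 2}"
    by auto
  have "(\<lambda>y. charfun (decode_real y) n) \<in> borel_measurable borel" for n
  proof -
    have "(\<lambda>y. charfun (decode_real y) n) \<in> borel \<rightarrow>\<^sub>M count_space UNIV"
      unfolding charfun_def decode_real_def by simp
    then show ?thesis
      by (rule measurable_compose[of _ _ _ "\<lambda>z. z"]) simp
  qed
  then have "(\<lambda>y. charfun (decode_real y)) \<in> borel_measurable borel"
    by (rule measurable_coordinatewise_then_product)
  then have "(\<lambda>y. charfun (decode_real y)) -` B \<in> sets borel"
    using measurable_sets[OF _ B, of _ borel] by fastforce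
  moreover have "{y :: nat \<Rightarrow> real. \<forall>m. \<exists>n. n \<ge> m \<and> y n > 1 / 2} \<in> sets borel"
    by measurable
  ultimately show ?thesis
    unfolding eq by blast
qed

lemma L1set_limit_along:
  assumes "L \<in> L1set f"
  shows "infinite L" "baire1 (limit_along f L)"
    "(\<lambda>k. f (enumerate L k) x) \<longlonglongrightarrow> limit_along f L x"
proof -
  obtain g where g: "baire1 g" "\<And>x. (\<lambda>k. f (enumerate L k) x) \<longlonglongrightarrow> g x" "infinite L"
    using assms by (auto simp: L1set_def infsets_def subseq_along_def)
  have "limit_along f L = g"
    using g(2) by (auto simp: limit_along_def subseq_along_def intro: limI)
  then show "infinite L" "baire1 (limit_along f L)"
    "(\<lambda>k. f (enumerate L k) x) \<longlonglongrightarrow> limit_along f L x"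
    using g by auto
qed

text \<open>The sets must be Borel jointly in both variables, since L and x both vary along a
  branch. Membership in C guarantees the convergence that the limit criterion assumes.\<close>

lemma limit_along_levels_borel:
  fixes f :: "nat \<Rightarrow> 'a::second_countable_topology \<Rightarrow> real"
  assumes f: "\<And>n. f n \<in> borel_measurable borel"
    and C: "borel_infsets C" "C \<subseteq> L1set f"
  shows "{(y, x). decode_real y \<in> C \<and> limit_along f (decode_real y) x < a} \<in> sets borel" (is "?A \<in> _")
    and "{(y, x). decode_real y \<in> C \<and> limit_along f (decode_real y) x > b} \<in> sets borel" (is "?B \<in> _")
proof -
  note [measurable] = f decode_real_borel[OF C(1)]
  have fst: "fst \<in> (borel :: ((nat \<Rightarrow> real) \<times> 'a) measure) \<rightarrow>\<^sub>M borel"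
    and snd: "snd \<in> (borel :: ((nat \<Rightarrow> real) \<times> 'a) measure) \<rightarrow>\<^sub>M borel"
    by (intro borel_measurable_continuous_onI continuous_intros)+
  note [measurable] = fst snd
  have less: "limit_along f L x < a \<longleftrightarrow>
      (\<exists>m N. \<forall>n\<ge>N. n \<in> L \<longrightarrow> f n x \<le> a - inverse (real (Suc m)))" if "L \<in> C" for L x a
    using that C(2) L1set_limit_along by (intro enumerate_subseq_limit_less_iff) blast+
  have greater: "limit_along f L x > b \<longleftrightarrow>
      (\<exists>m N. \<forall>n\<ge>N. n \<in> L \<longrightarrow> - f n x \<le> - b - inverse (real (Suc m)))" if "L \<in> C" for L x b
  proof -
    have "(\<lambda>k. - f (enumerate L k) x) \<longlonglongrightarrow> - limit_along f L x"
      using that C(2) L1set_limit_along(3) by (intro tendsto_minus) blast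
    then show ?thesis
      using enumerate_subseq_limit_less_iff[of L "\<lambda>n. - f n x" "- limit_along f L x" "- b"]
        that C(2) L1set_limit_along(1) by auto
  qed
  have *: "decode_real y \<in> C \<and> limit_along f (decode_real y) x < a \<longleftrightarrow> decode_real y \<in> C \<and>
      (\<exists>m N. \<forall>n\<ge>N. y n > 1 / 2 \<longrightarrow> f n x \<le> a - inverse (real (Suc m)))" for y x
    using less[of "decode_real y" x a] unfolding decode_real_def mem_Collect_eq by blast
  have **: "decode_real y \<in> C \<and> limit_along f (decode_real y) x > b \<longleftrightarrow> decode_real y \<in> C \<and>
      (\<exists>m N. \<forall>n\<ge>N. y n > 1 / 2 \<longrightarrow> - f n x \<le> - b - inverse (real (Suc m)))" for y x
    using greater[of "decode_real y" b x] unfolding decode_real_def mem_Collect_eq by blast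
  have "?A = fst -` {y. decode_real y \<in> C} \<inter>
      {p. \<exists>m N. \<forall>n\<ge>N. fst p n > 1 / 2 \<longrightarrow> f n (snd p) \<le> a - inverse (real (Suc m))}"
    by (simp only: set_eq_iff split_paired_All mem_Collect_eq prod.case Int_iff vimage_eq
        fst_conv snd_conv * simp_thms)
  moreover have "?B = fst -` {y. decode_real y \<in> C} \<inter>
      {p. \<exists>m N. \<forall>n\<ge>N. fst p n > 1 / 2 \<longrightarrow> - f n (snd p) \<le> - b - inverse (real (Suc m))}"
    by (simp only: set_eq_iff split_paired_All mem_Collect_eq prod.case Int_iff vimage_eq
        fst_conv snd_conv ** simp_thms)
  moreover have "fst -` {y. decode_real y \<in> C} \<in> sets (borel :: ((nat \<Rightarrow> real) \<times> 'a) measure)"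
    using measurable_sets[OF fst decode_real_borel[OF C(1)]] by simp
  moreover have "{p :: (nat \<Rightarrow> real) \<times> 'a. \<exists>m N. \<forall>n\<ge>N. fst p n > 1 / 2 \<longrightarrow>
      f n (snd p) \<le> a - inverse (real (Suc m))} \<in> sets borel"
    by measurable
  moreover have "{p :: (nat \<Rightarrow> real) \<times> 'a. \<exists>m N. \<forall>n\<ge>N. fst p n > 1 / 2 \<longrightarrow>
      - f n (snd p) \<le> - b - inverse (real (Suc m))} \<in> sets borel"
    by measurable
  ultimately show "?A \<in> sets borel" "?B \<in> sets borel"
    by simp_all
qed

subsection \<open>Chains of points\<close>

text \<open>If continuous \<open>h n\<close> converge to g, then for each N the points of D where
  some \<open>h n\<close> with n \<ge> N is small form a dense open subset of D, and so do those
  where some such \<open>h n\<close> is large. At a common point, given by Baire's theorem,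
  \<open>h n\<close> cannot converge.\<close>

lemma not_baire1_if_both_levels_dense:
  fixes g :: "'a::complete_space \<Rightarrow> real"
  assumes "a < b" "closed D" "D \<noteq> {}"
    and "D \<subseteq> closure (D \<inter> {x. g x < a})" "D \<subseteq> closure (D \<inter> {x. g x > b})"
  shows "\<not> baire1 g"
proof
  assume "baire1 g"
  then obtain h :: "nat \<Rightarrow> 'a \<Rightarrow> real" where cont: "\<And>n. continuous_on UNIV (h n)"
    and lim: "\<And>x. (\<lambda>n. h n x) \<longlonglongrightarrow> g x"
    unfolding baire1_def by blast
  \<comment> \<open>The midpoint leaves room for the two thresholds (a+c)/2 < (b+c)/2 strictly
    between a and b.\<close>
  define c where "c = (a + b) / 2"
  have c: "a < c" "c < b"
    using assms(1) by (auto simp: c_def)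
  define U where "U N = D \<inter> (\<Union>n\<in>{N..}. {x. h n x < (a + c) / 2})" for N
  define V where "V N = D \<inter> (\<Union>n\<in>{N..}. {x. (b + c) / 2 < h n x})" for N
  let ?X = "top_of_set D"
  have openU: "openin ?X (U N)" and openV: "openin ?X (V N)" for N
    unfolding U_def V_def using cont
    by (intro openin_open_Int open_UN ballI open_Collect_less continuous_on_const; simp)+
  have "D \<inter> {x. g x < a} \<subseteq> U N" for N
  proof
    fix x
    assume x: "x \<in> D \<inter> {x. g x < a}"
    then have "\<forall>\<^sub>F n in sequentially. h n x < (a + c) / 2"
      using c by (intro order_tendstoD(2)[OF lim]) auto
    then have "\<exists>n. h n x < (a + c) / 2 \<and> n \<ge> N"
      unfolding eventually_sequentially by (meson linorder_le_cases order_refl order_trans)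
    then show "x \<in> U N"
      using x by (auto simp: U_def)
  qed
  then have denseU: "D \<subseteq> closure (U N)" for N
    using assms(4) closure_mono by blast
  have "D \<inter> {x. g x > b} \<subseteq> V N" for N
  proof
    fix x
    assume x: "x \<in> D \<inter> {x. g x > b}"
    then have "\<forall>\<^sub>F n in sequentially. (b + c) / 2 < h n x"
      using c by (intro order_tendstoD(1)[OF lim]) auto
    then have "\<exists>n. (b + c) / 2 < h n x \<and> n \<ge> N"
      unfolding eventually_sequentially by (meson linorder_le_cases order_refl order_trans)
    then show "x \<in> V N"
      using x by (auto simp: V_def)
  qed
  then have denseV: "D \<subseteq> closure (V N)" for N
    using assms(5) closure_mono by blast
  have "U N \<subseteq> D" "V N \<subseteq> D" for N
    by (auto simp: U_def V_def)
  then have closU: "?X closure_of U N = D" and closV: "?X closure_of V N = D" for N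
    using denseU[of N] denseV[of N] by (auto simp: closure_of_subtopology Int_absorb1)
  have "?X closure_of \<Inter>(range U \<union> range V) = topspace ?X"
  proof (rule Baire_category)
    show "completely_metrizable_space ?X \<or> locally_compact_space ?X \<and> regular_space ?X"
      using assms(2) completely_metrizable_space_closedin completely_metrizable_space_euclidean
      by (metis closed_closedin)
  qed (use openU openV closU closV in auto)
  then have "\<Inter>(range U \<union> range V) \<noteq> {}"
    using assms(3) by auto
  then obtain z where "z \<in> \<Inter>(range U \<union> range V)"
    by blast
  then have z: "z \<in> U N" "z \<in> V N" for N
    by auto
  have "g z \<le> (a + c) / 2"
  proof (rule ccontr)
    assume "\<not> g z \<le> (a + c) / 2"
    then have "\<forall>\<^sub>F n in sequentially. (a + c) / 2 < h n z"
      by (intro order_tendstoD(1)[OF lim]) auto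
    then obtain N where "\<And>n. n \<ge> N \<Longrightarrow> (a + c) / 2 < h n z"
      by (auto simp: eventually_sequentially)
    then show False
      using z(1)[of N] by (force simp: U_def)
  qed
  moreover have "g z \<ge> (b + c) / 2"
  proof (rule ccontr)
    assume "\<not> g z \<ge> (b + c) / 2"
    then have "\<forall>\<^sub>F n in sequentially. h n z < (b + c) / 2"
      by (intro order_tendstoD(2)[OF lim]) auto
    then obtain N where "\<And>n. n \<ge> N \<Longrightarrow> h n z < (b + c) / 2"
      by (auto simp: eventually_sequentially)
    then show False
      using z(2)[of N] by (force simp: V_def)
  qed
  ultimately show False
    using c by simp
qed

text \<open>Step $k$, read as a pair $(i, c)$ with $i \le k$, demands that $x_k$ is within $1/(c+1)$ of $x_i$
  and lies below $a$ or above $b$ according to the parity of $c$. For $i = k$ the distance condition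
  is void.\<close>

definition low_step :: "nat \<Rightarrow> bool" where
  "low_step k \<longleftrightarrow> even (snd (prod_decode k))"

definition sep_chain :: "('a::metric_space \<Rightarrow> real) \<Rightarrow> real \<Rightarrow> real \<Rightarrow> (nat \<Rightarrow> 'a) \<Rightarrow> nat \<Rightarrow> bool" where
  "sep_chain g a b x n \<longleftrightarrow> (\<forall>k<n. (if low_step k then g (x k) < a else g (x k) > b) \<and>
     dist (x k) (x (fst (prod_decode k))) < inverse (real (Suc (snd (prod_decode k)))))"

lemma fst_prod_decode_le: "fst (prod_decode k) \<le> k"
  by (metis le_prod_encode_1 prod.collapse prod_decode_inverse)

text \<open>Step (i, c) puts a point within 1/(c+1) of \<open>x i\<close>; large even c and large
  odd c make both level sets dense in the closure of the range. Distances are bounded only weakly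
  because the lemma is applied to limits of chains.\<close>

lemma not_baire1_if_infinite_chain:
  fixes g :: "'a::complete_space \<Rightarrow> real"
  assumes "a < b"
    and level: "\<And>k. if low_step k then g (x k) < a else g (x k) > b"
    and near: "\<And>k. dist (x k) (x (fst (prod_decode k))) \<le> inverse (real (Suc (snd (prod_decode k))))"
  shows "\<not> baire1 g"
proof (rule not_baire1_if_both_levels_dense[OF assms(1), of "closure (range x)"])
  let ?D = "closure (range x)"
  have *: "?D \<subseteq> closure (?D \<inter> S)"
    if S: "\<And>i m. \<exists>c\<ge>m. x (prod_encode (i, c)) \<in> S" for S
  proof (rule closure_minimal)
    show "range x \<subseteq> closure (?D \<inter> S)"
    proof (clarsimp simp: closure_approachable)
      fix i and e :: real
      assume "e > 0"
      then obtain m where m: "inverse (real (Suc m)) < e"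
        using reals_Archimedean by blast
      obtain c where c: "c \<ge> m" "x (prod_encode (i, c)) \<in> S"
        using S by blast
      define k where "k = prod_encode (i, c)"
      have "inverse (real (Suc c)) \<le> inverse (real (Suc m))"
        using c(1) by simp
      moreover have "dist (x k) (x i) \<le> inverse (real (Suc c))"
        using near[of k] by (simp add: k_def)
      ultimately have "dist (x k) (x i) < e"
        using m by linarith
      moreover have "x k \<in> ?D"
        using closure_subset[of "range x"] by blast
      ultimately show "\<exists>y\<in>?D \<inter> S. dist y (x i) < e"
        using c(2) unfolding k_def by blast
    qed
  qed simp
  show "?D \<subseteq> closure (?D \<inter> {z. g z < a})"
  proof (rule *)
    fix i m
    have "x (prod_encode (i, 2 * m)) \<in> {z. g z < a}"
      using level[of "prod_encode (i, 2 * m)"] by (simp add: low_step_def)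
    then show "\<exists>c\<ge>m. x (prod_encode (i, c)) \<in> {z. g z < a}"
      by (intro exI[of _ "2 * m"]) simp
  qed
  show "?D \<subseteq> closure (?D \<inter> {z. g z > b})"
  proof (rule *)
    fix i m
    have "x (prod_encode (i, Suc (2 * m))) \<in> {z. g z > b}"
      using level[of "prod_encode (i, Suc (2 * m))"] by (simp add: low_step_def)
    then show "\<exists>c\<ge>m. x (prod_encode (i, c)) \<in> {z. g z > b}"
      by (intro exI[of _ "Suc (2 * m)"]) simp
  qed
qed auto

text \<open>The nodes are finite tables of naturals, so a single countable relation serves all L in
  C. Since \<nu> reads only the first n points, a chain can later be extended without moving its
  node.\<close>

lemma sep_chain_wf:
  fixes f :: "nat \<Rightarrow> 'a::polish_space \<Rightarrow> real"
  assumes f: "\<And>n. f n \<in> borel_measurable borel"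
    and C: "borel_infsets C" "C \<subseteq> L1set f"
    and "a < b"
  obtains R :: "nat list list rel" and \<nu> :: "nat set \<Rightarrow> (nat \<Rightarrow> 'a) \<Rightarrow> nat \<Rightarrow> nat list list"
  where "wf R" "\<And>L x y n. (\<And>k. k < n \<Longrightarrow> x k = y k) \<Longrightarrow> \<nu> L x n = \<nu> L y n"
    "\<And>L x n. L \<in> C \<Longrightarrow> sep_chain (limit_along f L) a b x (Suc n) \<Longrightarrow> (\<nu> L x (Suc n), \<nu> L x n) \<in> R"
proof -
  define A where "A s = (if s
      then {(y, x). decode_real y \<in> C \<and> limit_along f (decode_real y) x < a}
      else {(y, x). decode_real y \<in> C \<and> limit_along f (decode_real y) x > b})" for s
  have "souslin_witnessed (A s)" for s
    unfolding A_def using limit_along_levels_borel[OF f C] by (auto intro!: souslin_witnessed_borel)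
  then have "\<forall>s. \<exists>w :: (nat \<Rightarrow> real) \<times> 'a \<Rightarrow> nat \<Rightarrow> nat. \<forall>p u.
     (\<forall>\<^sub>F n in sequentially. p n \<in> A s) \<and> (\<forall>k. \<forall>\<^sub>F n in sequentially. w (p n) k = u k) \<longrightarrow>
     (\<exists>q\<in>A s. p \<longlonglongrightarrow> q)"
    unfolding souslin_witnessed_def by blast
  then obtain w :: "bool \<Rightarrow> (nat \<Rightarrow> real) \<times> 'a \<Rightarrow> nat \<Rightarrow> nat"
    where w: "\<And>s p u. \<forall>\<^sub>F n in sequentially. p n \<in> A s \<Longrightarrow>
      (\<And>k. \<forall>\<^sub>F n in sequentially. w s (p n) k = u k) \<Longrightarrow> \<exists>q\<in>A s. p \<longlonglongrightarrow> q"
    by metis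
  \<comment> \<open>An n by n table holds the first n witness entries of each of the first n points.
    Growing in both directions, it stays finite and eventually shows every entry.\<close>
  define \<nu> where "\<nu> L x n =
    map (\<lambda>k. map (w (low_step k) (encode_real L, x k)) [0..<n]) [0..<n]" for L x n
  \<comment> \<open>L and x are bound anew for each pair, so consecutive steps of a branch may come
    from different sets and points.\<close>
  define R where "R = {(\<nu> L x (Suc n), \<nu> L x n) | L x n.
    L \<in> C \<and> sep_chain (limit_along f L) a b x (Suc n)}"
  have "wf R"
    unfolding wf_iff_no_infinite_down_chain
  proof
    assume "\<exists>\<sigma>. \<forall>i. (\<sigma> (Suc i), \<sigma> i) \<in> R"
    then obtain \<sigma> where "\<And>i. (\<sigma> (Suc i), \<sigma> i) \<in> R"
      by blast
    then have "\<forall>i. \<exists>L x n. \<sigma> (Suc i) = \<nu> L x (Suc n) \<and> \<sigma> i = \<nu> L x n \<and> L \<in> C \<and>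
        sep_chain (limit_along f L) a b x (Suc n)"
      unfolding R_def by fast
    then obtain L x m where \<sigma>Suc: "\<And>i. \<sigma> (Suc i) = \<nu> (L i) (x i) (Suc (m i))"
      and \<sigma>: "\<And>i. \<sigma> i = \<nu> (L i) (x i) (m i)"
      and LC: "\<And>i. L i \<in> C"
      and chain: "\<And>i. sep_chain (limit_along f (L i)) a b (x i) (Suc (m i))"
      by metis
    have len: "length (\<nu> L x n) = n" for L x n
      by (simp add: \<nu>_def)
    \<comment> \<open>The length of a table is its level, so levels rise by one along the branch,
      though they need not start at 0.\<close>
    have m_Suc: "m (Suc i) = Suc (m i)" for i
      using arg_cong[OF \<sigma>Suc[of i], of length] unfolding \<sigma>[of "Suc i"] len .
    have m_ge: "i \<le> m i" for i
      by (induction i) (auto simp: m_Suc)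
    define v where "v i k j = w (low_step k) (encode_real (L i), x i k) j" for i k j
    have nth: "\<nu> (L i) (x i) n ! k ! j = v i k j" if "k < n" "j < n" for i n k j
      using that by (simp add: \<nu>_def v_def)
    have v_Suc: "v (Suc i) k j = v i k j" if "k \<le> i" "j \<le> i" for i k j
    proof -
      have lt: "k < Suc (m i)" "j < Suc (m i)"
        using that m_ge[of i] by auto
      have "\<nu> (L (Suc i)) (x (Suc i)) (Suc (m i)) = \<nu> (L i) (x i) (Suc (m i))"
        using \<sigma>[of "Suc i"] \<sigma>Suc[of i] m_Suc by simp
      then show ?thesis
        using nth[OF lt, of i] nth[OF lt, of "Suc i"] by simp
    qed
    define u where "u k j = v (max k j) k j" for k j
    have v_eq: "v i k j = u k j" if "max k j \<le> i" for i k j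
      using that by (induction rule: dec_induct) (simp_all add: u_def v_Suc)
    have at: "if low_step k then limit_along f (L i) (x i k) < a else limit_along f (L i) (x i k) > b"
      "dist (x i k) (x i (fst (prod_decode k))) < inverse (real (Suc (snd (prod_decode k))))"
      if "k \<le> i" for i k
      using chain[of i] m_ge[of i] that by (auto simp: sep_chain_def)
    have "\<exists>q\<in>A (low_step k). (\<lambda>i. (encode_real (L i), x i k)) \<longlonglongrightarrow> q" for k
    proof (rule w)
      show "\<forall>\<^sub>F i in sequentially. (encode_real (L i), x i k) \<in> A (low_step k)"
        using eventually_ge_at_top[of k]
      proof eventually_elim
        case (elim i)
        then show ?case
          using at(1)[of k i] LC by (simp add: A_def split: if_splits)
      qed
      show "\<forall>\<^sub>F i in sequentially. w (low_step k) (encode_real (L i), x i k) j = u k j" for j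
        using eventually_ge_at_top[of "max k j"] by eventually_elim (use v_eq v_def in simp)
    qed
    then obtain q where q: "\<And>k. q k \<in> A (low_step k)"
      and lim: "\<And>k. (\<lambda>i. (encode_real (L i), x i k)) \<longlonglongrightarrow> q k"
      by metis
    \<comment> \<open>The first component \<open>encode_real (L i)\<close> does not depend on k, so
      all the limits share one y, which decodes to the set in C sought for the
      contradiction.\<close>
    define y where "y = fst (q 0)"
    have "(\<lambda>i. encode_real (L i)) \<longlonglongrightarrow> fst (q k)" for k
      using tendsto_fst[OF lim[of k]] by simp
    then have fst_q: "fst (q k) = y" for k
      unfolding y_def by (metis LIMSEQ_unique)
    have x_lim: "(\<lambda>i. x i k) \<longlonglongrightarrow> snd (q k)" for k
      using tendsto_snd[OF lim[of k]] by simp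
    have in_A: "(y, snd (q k)) \<in> A (low_step k)" for k
      using q[of k] fst_q[of k] by (metis prod.collapse)
    have "\<not> baire1 (limit_along f (decode_real y))"
    proof (rule not_baire1_if_infinite_chain[OF \<open>a < b\<close>, of _ "\<lambda>k. snd (q k)"])
      fix k
      show "if low_step k then limit_along f (decode_real y) (snd (q k)) < a
        else limit_along f (decode_real y) (snd (q k)) > b"
        using in_A[of k] by (simp add: A_def split: if_splits)
      have "dist (x i k) (x i (fst (prod_decode k))) \<le> inverse (real (Suc (snd (prod_decode k))))"
        if "i \<ge> k" for i
        using at(2)[OF that] by simp
      then show "dist (snd (q k)) (snd (q (fst (prod_decode k)))) \<le>
          inverse (real (Suc (snd (prod_decode k))))"
        using LIMSEQ_le_const2[OF tendsto_dist[OF x_lim x_lim]] by blast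
    qed
    moreover have "decode_real y \<in> C"
      using in_A[of 0] by (simp add: A_def split: if_splits)
    ultimately show False
      using C(2) L1set_limit_along(2) by blast
  qed
  moreover have "\<nu> L x n = \<nu> L y n" if "\<And>k. k < n \<Longrightarrow> x k = y k" for L x y n
    using that by (simp add: \<nu>_def)
  moreover have "(\<nu> L x (Suc n), \<nu> L x n) \<in> R"
    if "L \<in> C" "sep_chain (limit_along f L) a b x (Suc n)" for L x n
    using that by (auto simp: R_def)
  ultimately show ?thesis
    using that by blast
qed

text \<open>Think of \<psi> as giving each chain a place in r that drops under extension. A chain
  inside a nonempty stage \<xi> extends inside every earlier stage, so \<xi> is at most its place.
  As \<tau> exceeds all places, its stage is empty.\<close>

lemma sep_iter_top_empty:
  fixes g :: "'a::metric_space \<Rightarrow> real" and r :: "'i rel"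
  assumes r: "Well_order r" "Field r = UNIV"
    and cong: "\<And>x y n. (\<And>k. k < n \<Longrightarrow> x k = y k) \<Longrightarrow> \<psi> x n = \<psi> y n"
    and desc: "\<And>x n. sep_chain g a b x (Suc n) \<Longrightarrow> (\<psi> x (Suc n), \<psi> x n) \<in> r - Id"
    and top: "\<And>x n. (\<psi> x n, \<tau>) \<in> r - Id"
  shows "sep_iter r g a b UNIV \<tau> = {}"
proof (rule ccontr)
  let ?F = "sep_iter r g a b UNIV"
  have wf: "wf (r - Id)" and tot: "total r" and anti: "antisym r" and refl: "refl r"
    using r
    by (auto simp: well_order_on_def linear_order_on_def partial_order_on_def preorder_on_def)
  have F: "closed (?F \<xi>)" "(\<eta>, \<xi>) \<in> r - Id \<Longrightarrow> ?F \<xi> \<subseteq> sep_deriv g a b (?F \<eta>)" for \<eta> \<xi>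
    using sep_iter_closed_decreasing[OF r(1) closed_UNIV] by blast+
  have le: "(\<xi>, \<psi> x n) \<in> r"
    if "sep_chain g a b x n" "\<And>k. k < n \<Longrightarrow> x k \<in> ?F \<xi>" "?F \<xi> \<noteq> {}" for \<xi> x n
    using wf that
  proof (induction \<xi> arbitrary: x n rule: wf_induct_rule)
    case (less \<xi>)
    show ?case
    proof (rule ccontr)
      define \<eta> where "\<eta> = \<psi> x n"
      assume "(\<xi>, \<psi> x n) \<notin> r"
      \<comment> \<open>If the claim fails, the place \<eta> of the chain is itself an earlier
        stage, so each point of stage \<xi> is approached by both low and high points of stage
        \<eta>.\<close>
      then have \<eta>: "(\<eta>, \<xi>) \<in> r - Id"
        using tot refl unfolding \<eta>_def total_on_def refl_on_def by (metis DiffI UNIV_I pair_in_Id_conv)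
      then have sub: "?F \<xi> \<subseteq> sep_deriv g a b (?F \<eta>)"
        by (rule F)
      define i where "i = fst (prod_decode n)"
      \<comment> \<open>For i = n there is no old point to approach and any point of stage \<xi>
        serves, which is where its nonemptiness enters.\<close>
      obtain p where p: "p \<in> ?F \<xi>" "i < n \<Longrightarrow> p = x i"
        using less.prems by blast
      obtain z where z: "z \<in> ?F \<eta>" "if low_step n then g z < a else g z > b"
        "dist z p < inverse (real (Suc (snd (prod_decode n))))"
      proof -
        have "p \<in> closure (?F \<eta> \<inter> {z. if low_step n then g z < a else g z > b})"
          using p(1) sub unfolding sep_deriv_def by (cases "low_step n") auto
        moreover have "0 < inverse (real (Suc (snd (prod_decode n))))"
          by simp
        ultimately show ?thesis
          using that unfolding closure_approachable by blast
      qed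
      define x' where "x' = x(n := z)"
      have old: "x' k = x k" if "k < n" for k
        using that by (simp add: x'_def)
      have new: "x' n = z"
        by (simp add: x'_def)
      \<comment> \<open>If i = n, then \<open>x' i\<close> is z itself and the distance is
        0.\<close>
      have "dist z (x' i) < inverse (real (Suc (snd (prod_decode n))))"
        using z(3) p(2) fst_prod_decode_le[of n] unfolding i_def x'_def
        by (cases "fst (prod_decode n) = n") auto
      moreover have "(if low_step k then g (x' k) < a else g (x' k) > b) \<and>
          dist (x' k) (x' (fst (prod_decode k))) < inverse (real (Suc (snd (prod_decode k))))"
        if "k < n" for k
        using less.prems(1) that old fst_prod_decode_le[of k] by (simp add: sep_chain_def)
      ultimately have chain: "sep_chain g a b x' (Suc n)"
        using z(2) new unfolding sep_chain_def less_Suc_eq i_def by metis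
      have "x' k \<in> ?F \<eta>" if "k < Suc n" for k
      proof (cases "k = n")
        case False
        then have "x k \<in> ?F \<xi>"
          using that less.prems(2) by simp
        then show ?thesis
          using sub sep_deriv_subset_closed[OF F(1)[of \<eta>], of g a b] False by (auto simp: x'_def)
      qed (use z(1) in \<open>simp add: x'_def\<close>)
      \<comment> \<open>By the induction hypothesis \<eta> is at most the place of the longer chain,
        which in turn is strictly below \<eta>, the place of the old one.\<close>
      then have "(\<eta>, \<psi> x' (Suc n)) \<in> r"
        using less.IH[OF \<eta> chain] z(1) by blast
      moreover have "(\<psi> x' (Suc n), \<eta>) \<in> r - Id"
        using desc[OF chain] cong[of n x' x] old unfolding \<eta>_def by metis
      ultimately show False
        using anti by (auto dest: antisymD)
    qed
  qed
  assume "?F \<tau> \<noteq> {}"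
  \<comment> \<open>The empty chain meets every condition whatever the sequence is, so
    \<open>undefined\<close> will do.\<close>
  then have "(\<tau>, \<psi> undefined 0) \<in> r"
    by (intro le) (auto simp: sep_chain_def)
  then show False
    using top[of undefined 0] anti by (auto dest: antisymD)
qed

section \<open>One well-order for all rational pairs and all L in C\<close>

theorem theorem4p5:
  fixes f :: "nat \<Rightarrow> 'a::polish_space \<Rightarrow> real"
    and C :: "nat set set"
  assumes "\<And>n. f n \<in> borel_measurable borel"
    and "borel_infsets C"
    and "C \<subseteq> L1set f"
  shows "\<exists>r :: nat rel. Well_order r \<and>
           (\<forall>L\<in>C. sep_rank_bounded_by r (limit_along f L))"
proof -
  \<comment> \<open>Well-foundedness is demanded for every pair, the chain conditions only for a <
    b. This makes the choice of R total, as needed to combine all the relations.\<close>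
  define good where "good = (\<lambda>(c :: rat \<times> rat) R (\<nu> :: nat set \<Rightarrow> (nat \<Rightarrow> 'a) \<Rightarrow> nat \<Rightarrow> nat list list).
    wf R \<and> (fst c < snd c \<longrightarrow>
      (\<forall>L x y n. (\<forall>k<n. x k = y k) \<longrightarrow> \<nu> L x n = \<nu> L y n) \<and>
      (\<forall>L x n. L \<in> C \<and> sep_chain (limit_along f L) (of_rat (fst c)) (of_rat (snd c)) x (Suc n) \<longrightarrow>
        (\<nu> L x (Suc n), \<nu> L x n) \<in> R)))"
  have "\<exists>R \<nu>. good c R \<nu>" for c
  proof (cases "fst c < snd c")
    case True
    then have "real_of_rat (fst c) < real_of_rat (snd c)"
      by (simp add: of_rat_less)
    from sep_chain_wf[OF assms this] obtain R :: "nat list list rel"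
      and \<nu> :: "nat set \<Rightarrow> (nat \<Rightarrow> 'a) \<Rightarrow> nat \<Rightarrow> nat list list"
      where "wf R" "\<And>L x y n. (\<And>k. k < n \<Longrightarrow> x k = y k) \<Longrightarrow> \<nu> L x n = \<nu> L y n"
        "\<And>L x n. L \<in> C \<Longrightarrow>
          sep_chain (limit_along f L) (of_rat (fst c)) (of_rat (snd c)) x (Suc n) \<Longrightarrow>
          (\<nu> L x (Suc n), \<nu> L x n) \<in> R"
      by blast
    then have "good c R \<nu>"
      unfolding good_def by blast
    then show ?thesis
      by blast
  qed (auto simp: good_def)
  then obtain R \<nu> where good: "\<And>c. good c (R c) (\<nu> c)"
    by metis
  have wf: "wf (R c)" for c
    using good[of c] by (simp add: good_def)
  have cong: "\<nu> (a, b) L x n = \<nu> (a, b) L y n"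
    if "a < b" "\<And>k. k < n \<Longrightarrow> x k = y k" for a b L n and x y :: "nat \<Rightarrow> 'a"
    using good[of "(a, b)"] that by (simp add: good_def)
  have desc: "(\<nu> (a, b) L x (Suc n), \<nu> (a, b) L x n) \<in> R (a, b)"
    if "a < b" "L \<in> C" "sep_chain (limit_along f L) (of_rat a) (of_rat b) x (Suc n)" for a b L x n
    using good[of "(a, b)"] that by (simp add: good_def)
  \<comment> \<open>Rational pairs and tables are both countable, so all relations fit below one
    \<tau>, the same for all pairs and all L.\<close>
  obtain r :: "nat rel" and \<phi> \<tau> where r: "Well_order r" "Field r = UNIV"
    and top: "\<And>c \<mu>. (\<phi> c \<mu>, \<tau>) \<in> r - Id"
    and \<phi>: "\<And>c \<mu> \<mu>'. (\<mu>, \<mu>') \<in> R c \<Longrightarrow> (\<phi> c \<mu>, \<phi> c \<mu>') \<in> r - Id"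
    using wf_family_embed_Well_order[of R, OF wf] by metis
  have "sep_rank_bounded_by r (limit_along f L)" if "L \<in> C" for L
    unfolding sep_rank_bounded_by_def
  proof (intro ballI impI)
    fix a b :: real
    assume "a \<in> \<rat>" "b \<in> \<rat>" "a < b"
    then obtain a' b' where ab: "a = of_rat a'" "b = of_rat b'" "a' < b'"
      by (auto elim!: Rats_cases simp: of_rat_less)
    have "sep_iter r (limit_along f L) a b UNIV \<tau> = {}"
    proof (rule sep_iter_top_empty[OF r, of "\<lambda>x n. \<phi> (a', b') (\<nu> (a', b') L x n)"])
      show "\<phi> (a', b') (\<nu> (a', b') L x n) = \<phi> (a', b') (\<nu> (a', b') L y n)"
        if "\<And>k. k < n \<Longrightarrow> x k = y k" for x y n
        using cong[OF ab(3) that] by simp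
      show "(\<phi> (a', b') (\<nu> (a', b') L x (Suc n)), \<phi> (a', b') (\<nu> (a', b') L x n)) \<in> r - Id"
        if "sep_chain (limit_along f L) a b x (Suc n)" for x n
        using desc[OF ab(3) \<open>L \<in> C\<close>] that ab \<phi> by blast
    qed (rule top)
    then show "\<exists>\<xi>\<in>Field r. sep_iter r (limit_along f L) a b UNIV \<xi> = {}"
      using r(2) by blast
  qed
  with r(1) show ?thesis
    by blast
qed

end
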